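(* Let $A$ be a finitely generated abelian group, let $T=\operatorname{Tor}(A)$ be its torsion subgroup, and write $A\cong\mathbb{Z}^r\oplus T$ with $r$ a non-negative integer. Then $A$ admits an inverse ambiguous automorphism if and only if $r$ is even and $T$ admits an inverse ambiguous automorphism.
   Context: A bijection $f$ of a group $G$ onto itself is called inverse ambiguous if $f^{-1}(x)=f(x)^{-1}$ for every $x\in G$, where $f^{-1}(x)$ is the preimage of $x$ under $f$ and $f(x)^{-1}$ is the group inverse of $f(x)$. An inverse ambiguous automorphism is a group automorphism that is inverse ambiguous; for an abelian group written additively, this means an automorphism $J$ with $J^{-1}(x)=-J(x)$ for all $x$. *)

theory Defs
  imports "HOL-Algebra.Product_Groups"
begin

definition finitely_generated_group :: "('a, 'b) monoid_scheme \<Rightarrow> bool"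
  where "finitely_generated_group G \<longleftrightarrow>
    group G \<and> (\<exists>S. finite S \<and> S \<subseteq> carrier G \<and> generate G S = carrier G)"

definition inverse_ambiguous :: "('a, 'b) monoid_scheme \<Rightarrow> ('a \<Rightarrow> 'a) \<Rightarrow> bool"
  where "inverse_ambiguous G f \<longleftrightarrow>
    bij_betw f (carrier G) (carrier G) \<and>
    (\<forall>x\<in>carrier G. inv_into (carrier G) f x = inv\<^bsub>G\<^esub> (f x))"

definition inverse_ambiguous_automorphism :: "('a, 'b) monoid_scheme \<Rightarrow> ('a \<Rightarrow> 'a) \<Rightarrow> bool"
  where "inverse_ambiguous_automorphism G J \<longleftrightarrow> J \<in> iso G G \<and> inverse_ambiguous G J"

text \<open>The exponent \<open>n\<close> has to be positive, since \<open>x [^] 0\<close> is always the identity.\<close>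

definition torsion_subgroup :: "('a, 'b) monoid_scheme \<Rightarrow> 'a set"
  where "torsion_subgroup G = {x \<in> carrier G. \<exists>n::nat. n > 0 \<and> x [^]\<^bsub>G\<^esub> n = \<one>\<^bsub>G\<^esub>}"

abbreviation torsion_group :: "('a, 'b) monoid_scheme \<Rightarrow> ('a, 'b) monoid_scheme"
  where "torsion_group G \<equiv> G\<lparr>carrier := torsion_subgroup G\<rparr>"

definition integer_power_group :: "nat \<Rightarrow> (nat \<Rightarrow> int) monoid"
  where "integer_power_group r = product_group {..<r} (\<lambda>_. integer_group)"

end

theory Submission
  imports Defs "Jordan_Normal_Form.Determinant"
begin

text \<open>A homomorphism \<open>J\<close> is inverse ambiguous iff \<open>J \<circ> J\<close> is inversion, which makes the notion easy
  to transport along isomorphisms and to combine in products. If \<open>J\<close> is such an automorphism of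
  \<open>\<int>\<^sup>r \<times> T\<close>, it preserves \<open>T\<close> and induces on \<open>\<int>\<^sup>r\<close> an integer matrix \<open>M\<close> with \<open>M\<^sup>2 = -1\<close>. Hence
  \<open>(det M)\<^sup>2 = (-1)\<^sup>r\<close>, which forces \<open>r\<close> to be even. Conversely, for even \<open>r\<close> one rotates each
  coordinate plane of \<open>\<int>\<^sup>r\<close> by a right angle.\<close>

section \<open>Inverse ambiguity as \<open>J \<circ> J\<close> being inversion\<close>

text \<open>Applying \<open>J\<close> to both sides of the defining identity turns it into a
  statement about \<open>J (J x)\<close>. Conversely, inversion is bijective, so a homomorphism
  squaring to it is bijective as well; bijectivity need not be checked separately later on.\<close>

lemma inverse_ambiguous_automorphism_iff:
  assumes "group G"
  shows "inverse_ambiguous_automorphism G J \<longleftrightarrow>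
    J \<in> hom G G \<and> (\<forall>x\<in>carrier G. J (J x) = inv\<^bsub>G\<^esub> x)"
proof
  interpret group G by fact
  assume J: "inverse_ambiguous_automorphism G J"
  then have hom: "J \<in> hom G G" and bij: "bij_betw J (carrier G) (carrier G)"
    and inv: "\<And>x. x \<in> carrier G \<Longrightarrow> inv_into (carrier G) J x = inv\<^bsub>G\<^esub> (J x)"
    by (auto simp: inverse_ambiguous_automorphism_def inverse_ambiguous_def iso_def)
  interpret J: group_hom G G J
    using hom by unfold_locales
  have "J (J x) = inv\<^bsub>G\<^esub> x" if x: "x \<in> carrier G" for x
  proof -
    have "inv\<^bsub>G\<^esub> (J (J x)) = J (inv\<^bsub>G\<^esub> (J x))" using x by simp
    also have "\<dots> = x"
      using bij_betw_inv_into_right[OF bij x] inv[OF x] by simp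
    finally show ?thesis using x by (metis J.hom_closed inv_inv)
  qed
  with hom show "J \<in> hom G G \<and> (\<forall>x\<in>carrier G. J (J x) = inv\<^bsub>G\<^esub> x)" by blast
next
  interpret group G by fact
  assume J: "J \<in> hom G G \<and> (\<forall>x\<in>carrier G. J (J x) = inv\<^bsub>G\<^esub> x)"
  then interpret J: group_hom G G J
    by unfold_locales auto
  have JJ: "J (J x) = inv\<^bsub>G\<^esub> x" if "x \<in> carrier G" for x using J that by blast
  have inj: "inj_on J (carrier G)"
    by (rule inj_onI) (metis JJ inv_inv)
  \<comment> \<open>This gives an explicit preimage of \<open>x\<close>, hence surjectivity, and
    with injectivity it identifies the inverse map.\<close>
  have right: "J (inv\<^bsub>G\<^esub> (J x)) = x" if "x \<in> carrier G" for x
    using that by (simp add: JJ)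
  have "J ` carrier G = carrier G"
  proof
    show "carrier G \<subseteq> J ` carrier G"
      using right by (metis J.hom_closed image_eqI inv_closed subsetI)
  qed auto
  with inj have bij: "bij_betw J (carrier G) (carrier G)"
    by (simp add: bij_betw_def)
  have "inv_into (carrier G) J x = inv\<^bsub>G\<^esub> (J x)" if "x \<in> carrier G" for x
    using inj right that by (metis J.hom_closed inv_closed inv_into_f_f)
  with J bij show "inverse_ambiguous_automorphism G J"
    by (auto simp: inverse_ambiguous_automorphism_def inverse_ambiguous_def iso_def)
qed

text \<open>Conjugating \<open>J\<close> by the isomorphism gives a map whose square is inversion
  conjugated, and homomorphisms commute with inversion.\<close>

lemma inverse_ambiguous_automorphism_transport:
  assumes G: "group G" and H: "group H" and "G \<cong> H"
    and J: "inverse_ambiguous_automorphism G J"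
  shows "\<exists>K. inverse_ambiguous_automorphism H K"
proof -
  obtain h where h: "h \<in> iso G H"
    using \<open>G \<cong> H\<close> by (auto simp: is_iso_def)
  define k where "k = inv_into (carrier G) h"
  have k: "k \<in> iso H G"
    using group.iso_set_sym[OF G h] by (simp add: k_def)
  have bij: "bij_betw h (carrier G) (carrier H)"
    using h by (simp add: iso_def)
  have kh: "k (h x) = x" if "x \<in> carrier G" for x
    using bij_betw_inv_into_left[OF bij that] by (simp add: k_def)
  have hk: "h (k y) = y" if "y \<in> carrier H" for y
    using bij_betw_inv_into_right[OF bij that] by (simp add: k_def)
  interpret h: group_hom G H h
    using G H h by (simp add: group_hom_def group_hom_axioms_def iso_def)
  interpret k: group_hom H G k
    using G H k by (simp add: group_hom_def group_hom_axioms_def iso_def)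
  have JJ: "J \<in> hom G G" "\<And>x. x \<in> carrier G \<Longrightarrow> J (J x) = inv\<^bsub>G\<^esub> x"
    using J by (auto simp: inverse_ambiguous_automorphism_iff[OF G])
  have "h \<circ> (J \<circ> k) \<in> hom H H"
    using hom_compose[OF hom_compose[OF k.homh JJ(1)] h.homh] by simp
  moreover have "(h \<circ> (J \<circ> k)) ((h \<circ> (J \<circ> k)) y) = inv\<^bsub>H\<^esub> y" if "y \<in> carrier H" for y
    using that JJ by (simp add: kh hk hom_in_carrier)
  ultimately show ?thesis
    by (auto simp: inverse_ambiguous_automorphism_iff[OF H])
qed

lemma inverse_ambiguous_automorphism_DirProd:
  assumes G: "group G" and H: "group H"
    and J: "inverse_ambiguous_automorphism G J" and K: "inverse_ambiguous_automorphism H K"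
  shows "inverse_ambiguous_automorphism (G \<times>\<times> H) (map_prod J K)"
proof -
  have "map_prod J K \<in> hom (G \<times>\<times> H) (G \<times>\<times> H)"
    using J K by (auto simp: inverse_ambiguous_automorphism_def iso_def hom_def)
  then show ?thesis
    using J K by (auto simp: inverse_ambiguous_automorphism_iff G H DirProd_group)
qed

section \<open>Torsion elements and the torsion-free factor\<close>

lemma hom_torsion_subgroup:
  assumes "group G" "group H" "f \<in> hom G H" "x \<in> torsion_subgroup G"
  shows "f x \<in> torsion_subgroup H"
proof -
  interpret group_hom G H f
    using assms by (simp add: group_hom_def group_hom_axioms_def)
  obtain n :: nat where "x \<in> carrier G" "n > 0" "x [^]\<^bsub>G\<^esub> n = \<one>\<^bsub>G\<^esub>"
    using assms(4) by (auto simp: torsion_subgroup_def)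
  moreover from this have "f x [^]\<^bsub>H\<^esub> n = \<one>\<^bsub>H\<^esub>"
    by (metis hom_nat_pow hom_one)
  ultimately show ?thesis
    by (auto simp: torsion_subgroup_def)
qed

lemma torsion_subgroup_subgroup:
  assumes "comm_group G"
  shows "subgroup (torsion_subgroup G) G"
proof -
  interpret comm_group G by fact
  show ?thesis
  proof (rule subgroupI)
    show "torsion_subgroup G \<subseteq> carrier G"
      by (auto simp: torsion_subgroup_def)
    have "\<one>\<^bsub>G\<^esub> \<in> torsion_subgroup G"
      by (auto simp: torsion_subgroup_def intro: exI[of _ 1])
    then show "torsion_subgroup G \<noteq> {}" by blast
    show "inv\<^bsub>G\<^esub> a \<in> torsion_subgroup G" if "a \<in> torsion_subgroup G" for a
      using that by (auto simp: torsion_subgroup_def nat_pow_inv)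
    show "a \<otimes>\<^bsub>G\<^esub> b \<in> torsion_subgroup G"
      if ab: "a \<in> torsion_subgroup G" "b \<in> torsion_subgroup G" for a b
    proof -
      obtain m n :: nat where mn: "a \<in> carrier G" "b \<in> carrier G" "m > 0" "n > 0"
        "a [^]\<^bsub>G\<^esub> m = \<one>\<^bsub>G\<^esub>" "b [^]\<^bsub>G\<^esub> n = \<one>\<^bsub>G\<^esub>"
        using ab by (auto simp: torsion_subgroup_def)
      \<comment> \<open>A common exponent for both factors; commutativity then lets the power
        distribute over the product.\<close>
      have "a [^]\<^bsub>G\<^esub> (m * n) = \<one>\<^bsub>G\<^esub>" "b [^]\<^bsub>G\<^esub> (m * n) = \<one>\<^bsub>G\<^esub>"
        using mn by (metis nat_pow_pow nat_pow_one, metis nat_pow_pow nat_pow_one mult.commute)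
      with mn have "(a \<otimes>\<^bsub>G\<^esub> b) [^]\<^bsub>G\<^esub> (m * n) = \<one>\<^bsub>G\<^esub>"
        by (simp add: nat_pow_distrib)
      with mn show ?thesis
        by (auto simp: torsion_subgroup_def intro!: exI[of _ "m * n"])
    qed
  qed
qed

text \<open>Powers in the subgroup are computed as in \<open>G\<close>. This provides the assumption
  \<open>tors\<close> below for the torsion factor.\<close>

lemma torsion_subgroup_torsion_group:
  "torsion_subgroup (torsion_group G) = torsion_subgroup G"
  by (auto simp: torsion_subgroup_def nat_pow_def)

lemma inverse_ambiguous_automorphism_torsion_group:
  assumes "comm_group G" and J: "inverse_ambiguous_automorphism G J"
  shows "inverse_ambiguous_automorphism (torsion_group G) J"
proof -
  interpret comm_group G by fact
  have sub: "subgroup (torsion_subgroup G) G"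
    by (rule torsion_subgroup_subgroup) fact
  have T: "group (torsion_group G)"
    by (rule subgroup.subgroup_is_group[OF sub is_group])
  have J': "J \<in> hom G G" "\<And>x. x \<in> carrier G \<Longrightarrow> J (J x) = inv\<^bsub>G\<^esub> x"
    using J by (auto simp: inverse_ambiguous_automorphism_iff is_group)
  have TG: "x \<in> carrier G" if "x \<in> torsion_subgroup G" for x
    using that by (simp add: torsion_subgroup_def)
  have "J \<in> hom (torsion_group G) (torsion_group G)"
    using hom_torsion_subgroup[OF is_group is_group J'(1)] J'(1) TG by (auto simp: hom_def)
  then show ?thesis
    using J' TG m_inv_consistent[OF sub] by (simp add: inverse_ambiguous_automorphism_iff T)
qed

text \<open>The torsion factor is mapped into itself, so \<open>J\<close> descends to the torsion-free quotient.\<close>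

lemma inverse_ambiguous_automorphism_torsion_free_factor:
  assumes G: "group G" and H: "group H"
    and free: "torsion_subgroup G \<subseteq> {\<one>\<^bsub>G\<^esub>}" and tors: "torsion_subgroup H = carrier H"
    and J: "inverse_ambiguous_automorphism (G \<times>\<times> H) J"
  shows "inverse_ambiguous_automorphism G (\<lambda>x. fst (J (x, \<one>\<^bsub>H\<^esub>)))"
proof -
  interpret G: group G by fact
  interpret H: group H by fact
  have P: "group (G \<times>\<times> H)" by (rule DirProd_group[OF G H])
  have J': "J \<in> hom (G \<times>\<times> H) (G \<times>\<times> H)"
    "\<And>x. x \<in> carrier (G \<times>\<times> H) \<Longrightarrow> J (J x) = inv\<^bsub>G \<times>\<times> H\<^esub> x"
    using J by (auto simp: inverse_ambiguous_automorphism_iff P)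
  have left: "(\<lambda>x. (x, \<one>\<^bsub>H\<^esub>)) \<in> hom G (G \<times>\<times> H)"
    and right: "(\<lambda>t. (\<one>\<^bsub>G\<^esub>, t)) \<in> hom H (G \<times>\<times> H)"
    and fst: "fst \<in> hom (G \<times>\<times> H) G"
    by (auto simp: hom_def)
  have M: "(\<lambda>x. fst (J (x, \<one>\<^bsub>H\<^esub>))) \<in> hom G G"
    using hom_compose[OF hom_compose[OF left J'(1)] fst] by (simp add: comp_def)
  have N: "(\<lambda>t. fst (J (\<one>\<^bsub>G\<^esub>, t))) \<in> hom H G"
    using hom_compose[OF hom_compose[OF right J'(1)] fst] by (simp add: comp_def)
  \<comment> \<open>The component of \<open>J\<close> from \<open>H\<close> to \<open>G\<close> is
    trivial: it sends torsion elements to torsion elements, and \<open>G\<close> has only the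
    trivial one.\<close>
  have N1: "fst (J (\<one>\<^bsub>G\<^esub>, t)) = \<one>\<^bsub>G\<^esub>" if "t \<in> carrier H" for t
    using hom_torsion_subgroup[OF H G N, of t] free tors that by auto
  have "fst (J (fst (J (x, \<one>\<^bsub>H\<^esub>)), \<one>\<^bsub>H\<^esub>)) = inv\<^bsub>G\<^esub> x" if x: "x \<in> carrier G" for x
  proof -
    obtain y t where yt: "J (x, \<one>\<^bsub>H\<^esub>) = (y, t)" by fastforce
    with x J'(1) have y: "y \<in> carrier G" and t: "t \<in> carrier H"
      using hom_in_carrier[OF J'(1), of "(x, \<one>\<^bsub>H\<^esub>)"] by auto
    \<comment> \<open>Splitting off \<open>t\<close> shows, by \<open>N1\<close>, that discarding
      the torsion part after the first application of \<open>J\<close> does not change the first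
      component after the second.\<close>
    have "J (y, t) = J ((y, \<one>\<^bsub>H\<^esub>) \<otimes>\<^bsub>G \<times>\<times> H\<^esub> (\<one>\<^bsub>G\<^esub>, t))"
      using y t by simp
    also have "\<dots> = J (y, \<one>\<^bsub>H\<^esub>) \<otimes>\<^bsub>G \<times>\<times> H\<^esub> J (\<one>\<^bsub>G\<^esub>, t)"
      using y t by (intro hom_mult[OF J'(1)]) auto
    finally have "fst (J (y, t)) = fst (J (y, \<one>\<^bsub>H\<^esub>)) \<otimes>\<^bsub>G\<^esub> fst (J (\<one>\<^bsub>G\<^esub>, t))"
      by (simp add: mult_DirProd')
    also have "\<dots> = fst (J (y, \<one>\<^bsub>H\<^esub>))"
      using y t hom_in_carrier[OF M y] by (simp add: N1)
    finally have "fst (J (y, \<one>\<^bsub>H\<^esub>)) = fst (J (J (x, \<one>\<^bsub>H\<^esub>)))"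
      using yt by simp
    also have "\<dots> = inv\<^bsub>G\<^esub> x"
      using x by (simp add: J'(2) G H)
    finally show ?thesis using yt by simp
  qed
  with M show ?thesis
    by (simp add: inverse_ambiguous_automorphism_iff G)
qed

section \<open>The free group of rank \<open>r\<close> and its quarter turn\<close>

lemma group_integer_power_group [simp]: "group (integer_power_group r)"
  by (simp add: integer_power_group_def)

lemma carrier_integer_power_group [simp]:
  "carrier (integer_power_group r) = {..<r} \<rightarrow>\<^sub>E UNIV"
  by (simp add: integer_power_group_def)

lemma mult_integer_power_group [simp]:
  "x \<otimes>\<^bsub>integer_power_group r\<^esub> y = (\<lambda>i\<in>{..<r}. x i + y i)"
  by (simp add: integer_power_group_def)

lemma one_integer_power_group [simp]:
  "\<one>\<^bsub>integer_power_group r\<^esub> = (\<lambda>i\<in>{..<r}. 0)"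
  by (simp add: integer_power_group_def)

lemma inv_integer_power_group [simp]:
  "x \<in> {..<r} \<rightarrow>\<^sub>E UNIV \<Longrightarrow> inv\<^bsub>integer_power_group r\<^esub> x = (\<lambda>i\<in>{..<r}. - x i)"
  by (simp add: integer_power_group_def)

lemma torsion_subgroup_integer_power_group:
  "torsion_subgroup (integer_power_group r) \<subseteq> {\<one>\<^bsub>integer_power_group r\<^esub>}"
proof
  fix x assume "x \<in> torsion_subgroup (integer_power_group r)"
  then obtain n :: nat where x: "x \<in> {..<r} \<rightarrow>\<^sub>E UNIV" and "n > 0"
    and pow: "x [^]\<^bsub>integer_power_group r\<^esub> n = \<one>\<^bsub>integer_power_group r\<^esub>"
    by (auto simp: torsion_subgroup_def)
  have "(x [^]\<^bsub>integer_power_group r\<^esub> m) i = int m * x i" if "i < r" for m :: nat and i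
    using that by (induction m) (simp_all add: algebra_simps)
  with pow \<open>n > 0\<close> have "x i = 0" if "i < r" for i
    using that by (metis lessThan_iff mult_eq_0_iff of_nat_eq_0_iff one_integer_power_group
        order_less_irrefl restrict_apply')
  with x show "x \<in> {\<one>\<^bsub>integer_power_group r\<^esub>}"
    by (auto simp: fun_eq_iff PiE_iff extensional_def)
qed

text \<open>On each pair of coordinates \<open>i\<close>, \<open>Suc i\<close> with \<open>i\<close>
  even, the map is \<open>(a, b) \<mapsto> (-b, a)\<close>, whose square is negation.\<close>

lemma inverse_ambiguous_automorphism_integer_power_group:
  assumes "even r"
  shows "inverse_ambiguous_automorphism (integer_power_group r)
    (\<lambda>x. \<lambda>i\<in>{..<r}. if even i then - x (Suc i) else x (i - 1))"
    (is "inverse_ambiguous_automorphism _ ?J")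
proof -
  \<comment> \<open>Evenness of \<open>r\<close> ensures that no coordinate lacks its
    partner.\<close>
  have suc: "Suc i < r" if "even i" "i < r" for i
    using that assms by (metis Suc_lessI even_Suc)
  have "?J \<in> hom (integer_power_group r) (integer_power_group r)"
    using suc by (intro homI) (auto intro!: restrict_ext)
  moreover have "?J (?J x) = inv\<^bsub>integer_power_group r\<^esub> x"
    if "x \<in> carrier (integer_power_group r)" for x
    using that suc by (auto intro!: restrict_ext)
  ultimately show ?thesis
    by (simp add: inverse_ambiguous_automorphism_iff)
qed

section \<open>Integer matrices and the parity of the rank\<close>

text \<open>Functions on \<open>nat\<close> that are only tested on \<open>{..<r}\<close> stand for integer vectors of length \<open>r\<close>.\<close>

lemma additive_functional_eq_sum:
  fixes g :: "(nat \<Rightarrow> int) \<Rightarrow> int"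
  assumes add: "\<And>x y. g (\<lambda>i. x i + y i) = g x + g y"
    and cong: "\<And>x y. (\<And>i. i < r \<Longrightarrow> x i = y i) \<Longrightarrow> g x = g y"
  shows "g x = (\<Sum>j<r. g (\<lambda>i. of_bool (i = j)) * x j)"
proof -
  have zero: "g (\<lambda>i. 0) = 0"
    using add[of "\<lambda>i. 0" "\<lambda>i. 0"] by simp
  \<comment> \<open>Additivity implies homogeneity over the integers, by induction upwards and
    downwards from 0.\<close>
  have scale: "g (\<lambda>i. c * e i) = c * g e" for c :: int and e
  proof (induction c rule: int_induct[where k = 0])
    case base
    then show ?case using zero by simp
  next
    case (step1 c)
    then show ?case using add[of "\<lambda>i. c * e i" e] by (simp add: algebra_simps)
  next
    case (step2 c)
    then show ?case using add[of "\<lambda>i. (c - 1) * e i" e] by (simp add: algebra_simps)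
  qed
  \<comment> \<open>Truncating \<open>x\<close> at \<open>k\<close> allows adding one multiple of a
    unit vector at a time; by \<open>cong\<close>, truncation at \<open>r\<close> does not affect
    \<open>g x\<close>.\<close>
  have "g (\<lambda>i. if i < k then x i else 0) = (\<Sum>j<k. g (\<lambda>i. of_bool (i = j)) * x j)" for k
  proof (induction k)
    case 0
    then show ?case using zero by simp
  next
    case (Suc k)
    have "(\<lambda>i. if i < Suc k then x i else 0)
        = (\<lambda>i. (if i < k then x i else 0) + x k * of_bool (i = k))"
      by (auto simp: fun_eq_iff less_Suc_eq)
    then have "g (\<lambda>i. if i < Suc k then x i else 0)
        = g (\<lambda>i. if i < k then x i else 0) + x k * g (\<lambda>i. of_bool (i = k))"
      by (simp only: add scale)
    then show ?case using Suc.IH by simp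
  qed
  moreover have "g x = g (\<lambda>i. if i < r then x i else 0)"
    by (rule cong) simp
  ultimately show ?thesis by simp
qed

lemma even_if_square_eq_uminus_one:
  fixes M :: "int mat"
  assumes M: "M \<in> carrier_mat r r" and MM: "M * M = - 1 \<cdot>\<^sub>m 1\<^sub>m r"
  shows "even r"
proof (rule ccontr)
  assume "odd r"
  have "det M * det M = det (M * M)"
    using det_mult[OF M M] by simp
  also have "\<dots> = - 1"
    using \<open>odd r\<close> by (simp add: MM)
  finally show False
    by (metis zero_le_square not_one_le_zero neg_0_le_iff_le)
qed

lemma even_if_inverse_ambiguous_automorphism_integer_power_group:
  assumes "inverse_ambiguous_automorphism (integer_power_group r) J"
  shows "even r"
proof -
  have J: "J \<in> hom (integer_power_group r) (integer_power_group r)"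
    "\<And>x. x \<in> {..<r} \<rightarrow>\<^sub>E UNIV \<Longrightarrow> J (J x) = (\<lambda>i\<in>{..<r}. - x i)"
    using assms by (auto simp: inverse_ambiguous_automorphism_iff)
  \<comment> \<open>Restricting the argument first makes coordinate \<open>i\<close> of
    \<open>J\<close> defined on all functions, so that plain pointwise addition can be used. The
    columns of \<open>M\<close> are the images of the unit vectors.\<close>
  define g where "g i x = J (restrict x {..<r}) i" for i x
  define M where "M = mat r r (\<lambda>(i, j). g i (\<lambda>k. of_bool (k = j)))"
  have add: "g i (\<lambda>k. x k + y k) = g i x + g i y" if "i < r" for i x y
  proof -
    have "J (restrict x {..<r} \<otimes>\<^bsub>integer_power_group r\<^esub> restrict y {..<r})
        = J (restrict x {..<r}) \<otimes>\<^bsub>integer_power_group r\<^esub> J (restrict y {..<r})"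
      by (rule hom_mult[OF J(1)]) auto
    moreover have "restrict (\<lambda>k. x k + y k) {..<r}
        = restrict x {..<r} \<otimes>\<^bsub>integer_power_group r\<^esub> restrict y {..<r}"
      by (auto simp: fun_eq_iff)
    ultimately show ?thesis using that by (simp add: g_def)
  qed
  have cong: "g i x = g i y" if "\<And>k. k < r \<Longrightarrow> x k = y k" for i x y
  proof -
    have "restrict x {..<r} = restrict y {..<r}"
      using that by (auto simp: fun_eq_iff)
    then show ?thesis by (simp add: g_def)
  qed
  have g: "g i x = (\<Sum>j<r. M $$ (i, j) * x j)" if "i < r" for i x
    using additive_functional_eq_sum[of "g i" r x, OF add[OF that] cong] that
    by (simp add: M_def)
  have gg: "g i (\<lambda>k. g k x) = - x i" if "i < r" for i x
  proof -
    have "J (restrict x {..<r}) \<in> {..<r} \<rightarrow>\<^sub>E UNIV"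
      using hom_in_carrier[OF J(1), of "restrict x {..<r}"] by simp
    \<comment> \<open>Values of \<open>J\<close> are extensional, so they are determined by their
      coordinates below \<open>r\<close>.\<close>
    then have "restrict (\<lambda>k. g k x) {..<r} = J (restrict x {..<r})"
      by (auto simp: g_def fun_eq_iff PiE_iff extensional_def)
    then have "g i (\<lambda>k. g k x) = J (J (restrict x {..<r})) i"
      by (simp add: g_def)
    then show ?thesis using that by (simp add: J(2))
  qed
  have M: "M \<in> carrier_mat r r" by (simp add: M_def)
  have "M * M = - 1 \<cdot>\<^sub>m 1\<^sub>m r"
  proof (rule eq_matI)
    fix i j assume "i < dim_row (- 1 \<cdot>\<^sub>m 1\<^sub>m r :: int mat)" "j < dim_col (- 1 \<cdot>\<^sub>m 1\<^sub>m r :: int mat)"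
    then have ij: "i < r" "j < r" by auto
    then have "(M * M) $$ (i, j) = (\<Sum>k<r. M $$ (i, k) * M $$ (k, j))"
      using M by (auto simp: scalar_prod_def atLeast0LessThan intro!: sum.cong)
    \<comment> \<open>With column \<open>j\<close> read as the image of the unit vector
      \<open>j\<close>, \<open>g\<close> folds the sum into a double application of
      \<open>J\<close>, which \<open>gg\<close> evaluates.\<close>
    also have "\<dots> = (\<Sum>k<r. M $$ (i, k) * g k (\<lambda>l. of_bool (l = j)))"
      using ij by (intro sum.cong) (auto simp: M_def)
    also have "\<dots> = - of_bool (i = j)"
      using ij g[of i] gg[of i "\<lambda>l. of_bool (l = j)"] by simp
    finally show "(M * M) $$ (i, j) = (- 1 \<cdot>\<^sub>m 1\<^sub>m r) $$ (i, j)"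
      using ij by simp
  qed (use M in auto)
  then show ?thesis
    using even_if_square_eq_uminus_one[OF M] by simp
qed

theorem theorem4p1:
  fixes A :: "('a, 'b) monoid_scheme" and r :: nat
  assumes "comm_group A"
    and "finitely_generated_group A"
    and "A \<cong> integer_power_group r \<times>\<times> torsion_group A"
  shows "(\<exists>J. inverse_ambiguous_automorphism A J) \<longleftrightarrow>
    even r \<and> (\<exists>J. inverse_ambiguous_automorphism (torsion_group A) J)"
proof -
  interpret comm_group A by fact
  have T: "group (torsion_group A)"
    by (rule subgroup.subgroup_is_group[OF torsion_subgroup_subgroup[OF assms(1)] is_group])
  have P: "group (integer_power_group r \<times>\<times> torsion_group A)"
    by (intro DirProd_group T) simp
  show ?thesis
  proof
    assume "\<exists>J. inverse_ambiguous_automorphism A J"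
    then obtain J where J: "inverse_ambiguous_automorphism A J" ..
    then obtain K where
      "inverse_ambiguous_automorphism (integer_power_group r \<times>\<times> torsion_group A) K"
      using inverse_ambiguous_automorphism_transport[OF is_group P assms(3)] by blast
    then have "even r"
      using even_if_inverse_ambiguous_automorphism_integer_power_group
        inverse_ambiguous_automorphism_torsion_free_factor[OF group_integer_power_group T
          torsion_subgroup_integer_power_group] torsion_subgroup_torsion_group[of A]
      by fastforce
    \<comment> \<open>The torsion half comes from restricting the original \<open>J\<close> on
      \<open>A\<close>; the decomposition served only for the parity.\<close>
    then show "even r \<and> (\<exists>J. inverse_ambiguous_automorphism (torsion_group A) J)"
      using inverse_ambiguous_automorphism_torsion_group[OF assms(1) J] by blast
  next
    assume "even r \<and> (\<exists>J. inverse_ambiguous_automorphism (torsion_group A) J)"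
    then obtain K where
      "inverse_ambiguous_automorphism (integer_power_group r \<times>\<times> torsion_group A) K"
      using inverse_ambiguous_automorphism_DirProd[OF group_integer_power_group T]
        inverse_ambiguous_automorphism_integer_power_group by blast
    then show "\<exists>J. inverse_ambiguous_automorphism A J"
      using inverse_ambiguous_automorphism_transport[OF P is_group iso_sym[OF assms(3)]] by blast
  qed
qed

end
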